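(* Let $H=\mathbb C[S_3]$, where $S_3$ is generated by $u,v$ with $u^2=v^2=e$, $uvu=vuv$, with the bicovariant calculus given by $\mathcal C=\{u,v,uvu\}$, framed by the Maurer–Cartan form $\{E_a\}$. The unique Levi-Civita connection $A_a=E_a-\frac13\theta$, $\theta=\sum_aE_a$, has constant curvature with respect to either of the two lifts (1) $i(E_a\wedge E_b)=E_a\otimes_HE_b-E_{aba^{-1}}\otimes_HE_a$, (2) $i(E_a\wedge E_b)=E_a\otimes_HE_b-\frac13\sum_{c,d\in\mathcal C,\,cd=ab}E_c\otimes_HE_d$ for $a\neq b$, in the sense that $$\mathrm{Ricci}=\mu\,(-g+\theta\otimes_H\theta),$$ where $g=3\sum_aE_a\otimes_HE_a$ is the metric induced by the braided-Killing form and $\mu=1$, $\mu=\frac23$ for the lifts (1), (2) respectively.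
   Context: $\mathbb C[S_3]$ is the algebra of complex functions on $S_3$, $R_a(f)=f((\ )a)$. $\Omega^1(H)$ is the free left $H$-module with basis $\{E_a\}_{a\in\mathcal C}$, with $E_af=R_a(f)E_a$ and $\mathrm df=\sum_a(R_a(f)-f)E_a$. $\Omega^2(H)=\Omega^1(H)\otimes_H\Omega^1(H)/\ker(\mathrm{id}-\Psi)$ with $\Psi(E_a\otimes_HE_b)=E_{aba^{-1}}\otimes_HE_a$; explicitly $E_a\wedge E_a=0$, $E_u\wedge E_v+E_v\wedge E_{uvu}+E_{uvu}\wedge E_u=0$, $E_v\wedge E_u+E_{uvu}\wedge E_v+E_u\wedge E_{uvu}=0$; and $\mathrm dE_a=\sum_b(E_a\wedge E_b+E_b\wedge E_a)$. The lifts are bimodule maps $i:\Omega^2(H)\to\Omega^1(H)\otimes_H\Omega^1(H)$. The curvature of a (regular) spin connection $\{A_a\}$ is $F_a=\mathrm dA_a+\sum_{c,d\in\mathcal C,\,cd=a}A_c\wedge A_d-\sum_b(A_b\wedge A_a+A_a\wedge A_b)$; for the Levi-Civita connection $F_a=\mathrm dE_a$. Writing $i(F_c)=\sum_{a,b}i(F)_c^{ab}E_a\otimes_HE_b$, the Ricci tensor is $$\mathrm{Ricci}=\sum_{a,b,c\in\mathcal C}i(F)_c^{ab}\,E_b\otimes_H(E_{c^{-1}ac}-E_a).$$ *)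

theory Defs
  imports
    Complex_Main
    "HOL-Library.Numeral_Type"
    "HOL-Library.Function_Algebras"
    "HOL-Combinatorics.Perm"
begin

unbundle permutation_syntax

section \<open>The group and the set of generators of the calculus\<close>

type_synonym s3 = "3 perm"

definition gen_u :: s3 where "gen_u = \<langle>1 \<leftrightarrow> 2\<rangle>"
definition gen_v :: s3 where "gen_v = \<langle>2 \<leftrightarrow> 3\<rangle>"

lemma u_square: "gen_u * gen_u = 1" and v_square: "gen_v * gen_v = 1"
  by (simp_all add: gen_u_def gen_v_def)

lemma inverse_u [simp]: "inverse gen_u = gen_u" and inverse_v [simp]: "inverse gen_v = gen_v"
  by (simp_all add: gen_u_def gen_v_def)

lemma swap_conj:
  assumes "a \<noteq> b" "b \<noteq> c" "a \<noteq> c"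
  shows "\<langle>a \<leftrightarrow> b\<rangle> * \<langle>b \<leftrightarrow> c\<rangle> * \<langle>a \<leftrightarrow> b\<rangle> = \<langle>a \<leftrightarrow> c\<rangle>"
  using assms by transfer (auto simp: fun_eq_iff transpose_def)

lemma u_v_u: "gen_u * gen_v * gen_u = \<langle>1 \<leftrightarrow> 3\<rangle>"
  unfolding gen_u_def gen_v_def by (rule swap_conj) simp_all

lemma v_u_v: "gen_v * gen_u * gen_v = \<langle>1 \<leftrightarrow> 3\<rangle>"
  unfolding gen_u_def gen_v_def
  using swap_conj[of "3::3" 2 1] by (simp add: swap_sym)

lemma braid_relation: "gen_u * gen_v * gen_u = gen_v * gen_u * gen_v"
  by (simp add: u_v_u v_u_v)

typedef cls = "{gen_u, gen_v, gen_u * gen_v * gen_u}"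
  morphisms elt Abs_cls
  by blast

instance cls :: finite
proof
  have "(UNIV :: cls set) = Abs_cls ` {gen_u, gen_v, gen_u * gen_v * gen_u}"
    by (metis type_definition.Abs_image type_definition_cls)
  then show "finite (UNIV :: cls set)"
    by (rule ssubst) (intro finite_imageI finite.intros)
qed

text \<open>\<open>Ad x a\<close> is \<open>x a x\<^sup>-\<^sup>1\<close>, again an element of the conjugacy class.\<close>

definition Ad :: "s3 \<Rightarrow> cls \<Rightarrow> cls" where
  "Ad x a = Abs_cls (x * elt a * inverse x)"

lemma elt_cases: "elt a = gen_u \<or> elt a = gen_v \<or> elt a = gen_u * gen_v * gen_u"
  using elt[of a] by auto

lemma inverse_elt [simp]: "inverse (elt a) = elt a"
  using elt_cases[of a] by (auto simp: u_v_u)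

lemma elt_square: "elt a * elt a = 1"
  using elt_cases[of a] by (auto simp: u_v_u u_square v_square)

lemma conj_closed: "elt a * elt b * elt a \<in> {gen_u, gen_v, gen_u * gen_v * gen_u}"
proof -
  have uu: "gen_u * (gen_u * x) = x" and vv: "gen_v * (gen_v * x) = x" for x :: s3
    by (simp_all add: u_square v_square flip: mult.assoc)
  have br: "gen_v * (gen_u * gen_v) = gen_u * (gen_v * gen_u)"
    using braid_relation by (simp add: mult.assoc)
  have br': "gen_v * (gen_u * (gen_v * x)) = gen_u * (gen_v * (gen_u * x))" for x :: s3
    using arg_cong[OF br, of "\<lambda>y. y * x"] by (simp add: mult.assoc)
  show ?thesis
    using elt_cases[of a] elt_cases[of b]
    by (auto simp: mult.assoc uu vv br br' u_square v_square)
qed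

lemma elt_Ad: "elt (Ad (elt a) b) = elt a * elt b * inverse (elt a)"
  using conj_closed[of a b] by (simp add: Ad_def Abs_cls_inverse)

section \<open>Functions, one-forms and tensors\<close>

type_synonym H = "s3 \<Rightarrow> complex"

definition R :: "s3 \<Rightarrow> H \<Rightarrow> H" where
  "R a f = (\<lambda>x. f (x * a))"

abbreviation const :: "complex \<Rightarrow> H" where
  "const c \<equiv> (\<lambda>_. c)"

text \<open>
  A one-form is its family of left coefficients in the basis \<open>E\<close>. As
  \<open>E\<^sub>a g = R\<^sub>a(g) E\<^sub>a\<close>, the tensor square over \<open>H\<close> is the free left module on the
  \<open>E\<^sub>a \<otimes> E\<^sub>b\<close>, and is represented by left coefficients as well; the
  balanced tensor product then reads
  \<open>(f E\<^sub>a) \<otimes> (g E\<^sub>b) = f R\<^sub>a(g) (E\<^sub>a \<otimes> E\<^sub>b)\<close>.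
\<close>

type_synonym form1 = "cls \<Rightarrow> H"
type_synonym tens2 = "cls \<Rightarrow> cls \<Rightarrow> H"

definition lact1 :: "H \<Rightarrow> form1 \<Rightarrow> form1"  (infixr \<open>\<cdot>\<^sub>1\<close> 75) where
  "f \<cdot>\<^sub>1 \<omega> = (\<lambda>a. f * \<omega> a)"

definition E :: "cls \<Rightarrow> form1" where
  "E a = (\<lambda>b. if b = a then 1 else 0)"

definition \<theta> :: form1 where
  "\<theta> = (\<Sum>a\<in>UNIV. E a)"

definition d0 :: "H \<Rightarrow> form1" where
  "d0 f = (\<Sum>a\<in>UNIV. (R (elt a) f - f) \<cdot>\<^sub>1 E a)"

definition tensor :: "form1 \<Rightarrow> form1 \<Rightarrow> tens2"  (infixl \<open>\<otimes>\<^sub>H\<close> 73) where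
  "\<omega> \<otimes>\<^sub>H \<eta> = (\<lambda>a b. \<omega> a * R (elt a) (\<eta> b))"

definition lact2 :: "H \<Rightarrow> tens2 \<Rightarrow> tens2"  (infixr \<open>\<cdot>\<^sub>2\<close> 70) where
  "f \<cdot>\<^sub>2 T = (\<lambda>a b. f * T a b)"

definition ract2 :: "tens2 \<Rightarrow> H \<Rightarrow> tens2"  (infixl \<open>\<triangleleft>\<^sub>2\<close> 70) where
  "T \<triangleleft>\<^sub>2 f = (\<lambda>a b. T a b * R (elt a * elt b) f)"

definition \<Psi> :: "tens2 \<Rightarrow> tens2" where
  "\<Psi> T = (\<Sum>a\<in>UNIV. \<Sum>b\<in>UNIV. T a b \<cdot>\<^sub>2 (E (Ad (elt a) b) \<otimes>\<^sub>H E a))"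

lemma sum_fun_apply: "(\<Sum>a\<in>A. f a) x = (\<Sum>a\<in>A. (f a :: 'b \<Rightarrow> 'c::comm_monoid_add) x)"
  by (induction A rule: infinite_finite_induct) simp_all

lemma E_tensor_E:
  "(E a \<otimes>\<^sub>H E b) c d = (if c = a \<and> d = b then 1 else 0)"
  by (auto simp: E_def tensor_def R_def fun_eq_iff)

lemma \<Psi>_apply:
  "\<Psi> T c d x = (\<Sum>a\<in>UNIV. \<Sum>b\<in>UNIV. if c = Ad (elt a) b \<and> d = a then T a b x else 0)"
  unfolding \<Psi>_def sum_fun_apply lact2_def E_tensor_E
  by (intro sum.cong refl) simp

lemma \<Psi>_add: "\<Psi> (S + T) = \<Psi> S + \<Psi> T"
  by (intro ext) (auto simp: \<Psi>_apply intro!: sum.cong simp flip: sum.distrib)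

lemma \<Psi>_uminus: "\<Psi> (- T) = - \<Psi> T"
  by (intro ext) (auto simp: \<Psi>_apply intro!: sum.cong simp flip: sum_negf)

lemma \<Psi>_diff: "\<Psi> (S - T) = \<Psi> S - \<Psi> T"
  using \<Psi>_add[of S "- T"] by (simp add: \<Psi>_uminus)

lemma \<Psi>_lact2: "\<Psi> (f \<cdot>\<^sub>2 T) = f \<cdot>\<^sub>2 \<Psi> T"
  by (intro ext) (auto simp: \<Psi>_apply lact2_def sum_distrib_left intro!: sum.cong)

lemma \<Psi>_ract2: "\<Psi> (T \<triangleleft>\<^sub>2 f) = \<Psi> T \<triangleleft>\<^sub>2 f"
proof -
  have "elt (Ad (elt a) b) * elt a = elt a * elt b" for a b
    by (simp add: elt_Ad mult.assoc elt_square)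
  then show ?thesis
    by (intro ext) (auto simp: \<Psi>_apply ract2_def R_def sum_distrib_right intro!: sum.cong)
qed

lemma lact2_diff: "f \<cdot>\<^sub>2 (S - T) = f \<cdot>\<^sub>2 S - f \<cdot>\<^sub>2 T"
  by (intro ext) (simp add: lact2_def right_diff_distrib)

lemma ract2_diff: "(S - T) \<triangleleft>\<^sub>2 f = S \<triangleleft>\<^sub>2 f - T \<triangleleft>\<^sub>2 f"
  by (intro ext) (simp add: ract2_def left_diff_distrib)

section \<open>Two-forms\<close>

definition form2_rel :: "tens2 \<Rightarrow> tens2 \<Rightarrow> bool" where
  "form2_rel S T \<longleftrightarrow> (S - T) - \<Psi> (S - T) = 0"

lemma form2_rel_iff: "form2_rel S T \<longleftrightarrow> S - \<Psi> S = T - \<Psi> T"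
  by (auto simp: form2_rel_def \<Psi>_diff algebra_simps)

quotient_type form2 = tens2 / form2_rel
  by (rule equivpI) (auto simp: reflp_def symp_def transp_def form2_rel_iff)

instantiation form2 :: ab_group_add
begin

lift_definition zero_form2 :: form2 is 0 .

lift_definition plus_form2 :: "form2 \<Rightarrow> form2 \<Rightarrow> form2" is "(+)"
  by (simp add: form2_rel_iff \<Psi>_add add_diff_add)

lift_definition uminus_form2 :: "form2 \<Rightarrow> form2" is uminus
  unfolding form2_rel_iff \<Psi>_uminus by (metis minus_diff_minus)

lift_definition minus_form2 :: "form2 \<Rightarrow> form2 \<Rightarrow> form2" is "(-)"
proof -
  fix S T S' T' :: tens2
  assume "form2_rel S T" and "form2_rel S' T'"
  then have eq: "S - \<Psi> S = T - \<Psi> T" "S' - \<Psi> S' = T' - \<Psi> T'"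
    by (simp_all only: form2_rel_iff)
  have split: "(X - Y) - \<Psi> (X - Y) = (X - \<Psi> X) - (Y - \<Psi> Y)" for X Y
    by (simp add: \<Psi>_diff algebra_simps)
  show "form2_rel (S - S') (T - T')"
    by (simp only: form2_rel_iff split eq)
qed

instance
  by standard (transfer, simp add: form2_rel_iff add_ac)+

end

lift_definition wedge :: "form1 \<Rightarrow> form1 \<Rightarrow> form2"  (infixl \<open>\<and>\<^sub>H\<close> 73) is tensor .

lift_definition lact_form2 :: "H \<Rightarrow> form2 \<Rightarrow> form2"  (infixr \<open>\<cdot>\<^sub>\<Omega>\<close> 70) is lact2
  by (simp add: form2_rel_iff \<Psi>_lact2 flip: lact2_diff)

lift_definition ract_form2 :: "form2 \<Rightarrow> H \<Rightarrow> form2"  (infixl \<open>\<triangleleft>\<^sub>\<Omega>\<close> 70) is ract2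
  by (simp add: form2_rel_iff \<Psi>_ract2 flip: ract2_diff)

definition dE :: "cls \<Rightarrow> form2" where
  "dE a = (\<Sum>b\<in>UNIV. E a \<and>\<^sub>H E b + E b \<and>\<^sub>H E a)"

text \<open>The graded Leibniz rule \<open>d(f E\<^sub>a) = df \<and> E\<^sub>a + f dE\<^sub>a\<close>.\<close>

definition d1 :: "form1 \<Rightarrow> form2" where
  "d1 \<omega> = (\<Sum>a\<in>UNIV. d0 (\<omega> a) \<and>\<^sub>H E a + \<omega> a \<cdot>\<^sub>\<Omega> dE a)"

section \<open>Lifts\<close>

definition bimodule_map :: "(form2 \<Rightarrow> tens2) \<Rightarrow> bool" where
  "bimodule_map i \<longleftrightarrow>
     (\<forall>\<alpha> \<beta>. i (\<alpha> + \<beta>) = i \<alpha> + i \<beta>) \<and>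
     (\<forall>f \<alpha>. i (f \<cdot>\<^sub>\<Omega> \<alpha>) = f \<cdot>\<^sub>2 i \<alpha>) \<and>
     (\<forall>\<alpha> f. i (\<alpha> \<triangleleft>\<^sub>\<Omega> f) = i \<alpha> \<triangleleft>\<^sub>2 f)"

definition lift_one :: "(form2 \<Rightarrow> tens2) \<Rightarrow> bool" where
  "lift_one i \<longleftrightarrow> bimodule_map i \<and>
     (\<forall>a b. i (E a \<and>\<^sub>H E b) = E a \<otimes>\<^sub>H E b - E (Ad (elt a) b) \<otimes>\<^sub>H E a)"

definition lift_two :: "(form2 \<Rightarrow> tens2) \<Rightarrow> bool" where
  "lift_two i \<longleftrightarrow> bimodule_map i \<and>
     (\<forall>a b. a \<noteq> b \<longrightarrow> i (E a \<and>\<^sub>H E b) = E a \<otimes>\<^sub>H E b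
        - const (1/3) \<cdot>\<^sub>2 (\<Sum>(c, d) | elt c * elt d = elt a * elt b. E c \<otimes>\<^sub>H E d))"

section \<open>Connections and curvature\<close>

text \<open>A spin connection is a family of one-forms indexed by the class.\<close>

definition regular :: "(cls \<Rightarrow> form1) \<Rightarrow> bool" where
  "regular A \<longleftrightarrow> (\<forall>x. x \<noteq> 1 \<and> x \<notin> range elt \<longrightarrow>
     (\<Sum>(c, d) | elt c * elt d = x. A c \<and>\<^sub>H A d) = 0)"

definition torsion :: "(cls \<Rightarrow> form1) \<Rightarrow> cls \<Rightarrow> form2" where
  "torsion A a = dE a + (\<Sum>b\<in>UNIV. A b \<and>\<^sub>H (E (Ad (inverse (elt b)) a) - E a))"

text \<open>
  Torsion of the dual coframing which the Ad-invariant metric \<open>3 \<Sum>\<^sub>a E\<^sub>a \<otimes> E\<^sub>a\<close>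
  identifies, up to the factor 3, with the framing itself.
\<close>

definition cotorsion :: "(cls \<Rightarrow> form1) \<Rightarrow> cls \<Rightarrow> form2" where
  "cotorsion A a = dE a + (\<Sum>b\<in>UNIV. (E (Ad (elt b) a) - E a) \<and>\<^sub>H A b)"

definition levi_civita :: "(cls \<Rightarrow> form1) \<Rightarrow> bool" where
  "levi_civita A \<longleftrightarrow>
     regular A \<and> (\<forall>a. torsion A a = 0) \<and> (\<forall>a. cotorsion A a = 0)"

definition curvature :: "(cls \<Rightarrow> form1) \<Rightarrow> cls \<Rightarrow> form2" where
  "curvature A a = d1 (A a)
     + (\<Sum>(c, d) | elt c * elt d = elt a. A c \<and>\<^sub>H A d)
     - (\<Sum>b\<in>UNIV. A b \<and>\<^sub>H A a + A a \<and>\<^sub>H A b)"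

definition ricci :: "(form2 \<Rightarrow> tens2) \<Rightarrow> (cls \<Rightarrow> form1) \<Rightarrow> tens2" where
  "ricci i A = (\<Sum>a\<in>UNIV. \<Sum>b\<in>UNIV. \<Sum>c\<in>UNIV.
     i (curvature A c) a b \<cdot>\<^sub>2 (E b \<otimes>\<^sub>H (E (Ad (inverse (elt c)) a) - E a)))"

text \<open>
  On the class, \<open>[a,[b,c]] = (ab) c (ab)\<^sup>-\<^sup>1\<close>, so the trace defining the braided-Killing
  form counts the \<open>c\<close> fixed under conjugation by \<open>ab\<close>.
\<close>

definition killing :: "cls \<Rightarrow> cls \<Rightarrow> complex" where
  "killing a b = of_nat (card {c. elt c * elt a * elt b = elt a * elt b * elt c})"

definition metric :: tens2 where
  "metric = (\<Sum>a\<in>UNIV. \<Sum>b\<in>UNIV. const (killing a b) \<cdot>\<^sub>2 (E a \<otimes>\<^sub>H E b))"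

unbundle no permutation_syntax

end

theory Submission
  imports Defs
begin

text \<open>
  The braiding permutes the nine tensors \<open>E\<^sub>a \<otimes> E\<^sub>b\<close>: it fixes the \<open>E\<^sub>a \<otimes> E\<^sub>a\<close> and has two orbits of size
  three, one for each product \<open>ab\<close> of order three. A two-form therefore vanishes iff the coefficients
  of a representative are constant on these two orbits.

  Writing \<open>A\<^sub>a = \<Sum>\<^sub>b A\<^sub>a\<^sup>b E\<^sub>b\<close> and \<open>p\<^sub>a = A\<^sub>a\<^sup>a\<close>, vanishing torsion says that \<open>A\<^sub>a\<^sup>b = p\<^sub>c - 1\<close> for
  \<open>{a, b, c}\<close> the whole class, and that \<open>\<Sum>\<^sub>a p\<^sub>a = 2\<close>. Vanishing cotorsion then says that
  \<open>p\<^sub>a(xu) = p\<^sub>a(xv) = p\<^sub>a(xuvu)\<close> for all \<open>x\<close>. In the regularity equations at \<open>uv\<close> and \<open>vu\<close> the quadratic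
  parts are constant on orbits and cancel, leaving linear equations between the values of \<open>p\<close> at \<open>x\<close>
  and at \<open>xu\<close> whose only solution is \<open>p\<^sub>a = 2/3\<close>.

  A bimodule lift is determined by its values on the \<open>E\<^sub>a \<and> E\<^sub>b\<close> with \<open>a \<noteq> b\<close>, and both lifts are
  combinations of powers of \<open>\<Psi>\<close> that factor through \<open>id - \<Psi>\<close>.
\<close>

unbundle permutation_syntax

section \<open>Multiplication in the group and conjugation on the class\<close>

definition gen_w :: s3 where "gen_w = gen_u * gen_v * gen_u"
definition rot :: s3 where "rot = gen_u * gen_v"
definition rot' :: s3 where "rot' = gen_v * gen_u"

lemma perm3_eq_iff:
  "p = q \<longleftrightarrow> p \<langle>$\<rangle> 1 = q \<langle>$\<rangle> 1 \<and> p \<langle>$\<rangle> 2 = q \<langle>$\<rangle> 2 \<and> p \<langle>$\<rangle> 3 = q \<langle>$\<rangle> 3" for p q :: s3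
proof -
  have exhaust: "(x :: 3) = 1 \<or> x = 2 \<or> x = 3" for x
  proof (induct x)
    case (of_int z)
    \<comment> \<open>In the type \<open>3\<close> the numeral 3 equals 0, so the residues 0, 1, 2
      are the elements 3, 1, 2.\<close>
    then have "z = 0 \<or> z = 1 \<or> z = 2" by fastforce
    then show ?case by auto
  qed
  have "p \<langle>$\<rangle> x = q \<langle>$\<rangle> x"
    if "p \<langle>$\<rangle> 1 = q \<langle>$\<rangle> 1" "p \<langle>$\<rangle> 2 = q \<langle>$\<rangle> 2" "p \<langle>$\<rangle> 3 = q \<langle>$\<rangle> 3" for x
    using that exhaust[of x] by auto
  then show ?thesis
    by (auto intro: perm_eqI)
qed

lemma apply_gen [simp]:
  "gen_u \<langle>$\<rangle> 1 = 2" "gen_u \<langle>$\<rangle> 2 = 1" "gen_u \<langle>$\<rangle> 3 = 3"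
  "gen_v \<langle>$\<rangle> 1 = 1" "gen_v \<langle>$\<rangle> 2 = 3" "gen_v \<langle>$\<rangle> 3 = 2"
  "gen_w \<langle>$\<rangle> 1 = 3" "gen_w \<langle>$\<rangle> 2 = 2" "gen_w \<langle>$\<rangle> 3 = 1"
proof -
  show "gen_u \<langle>$\<rangle> 1 = 2" "gen_u \<langle>$\<rangle> 2 = 1" "gen_u \<langle>$\<rangle> 3 = 3"
    "gen_v \<langle>$\<rangle> 1 = 1" "gen_v \<langle>$\<rangle> 2 = 3" "gen_v \<langle>$\<rangle> 3 = 2"
    by (simp_all add: gen_u_def gen_v_def)
  then show "gen_w \<langle>$\<rangle> 1 = 3" "gen_w \<langle>$\<rangle> 2 = 2" "gen_w \<langle>$\<rangle> 3 = 1"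
    by (simp_all add: gen_w_def apply_times)
qed

lemma apply_rot [simp]:
  "rot \<langle>$\<rangle> 1 = 2" "rot \<langle>$\<rangle> 2 = 3" "rot \<langle>$\<rangle> 3 = 1"
  "rot' \<langle>$\<rangle> 1 = 3" "rot' \<langle>$\<rangle> 2 = 1" "rot' \<langle>$\<rangle> 3 = 2"
  by (simp_all add: rot_def rot'_def apply_times)

lemma gen_mult:
  "gen_u * gen_u = 1" "gen_v * gen_v = 1" "gen_w * gen_w = 1"
  "gen_u * gen_v = rot" "gen_v * gen_w = rot" "gen_w * gen_u = rot"
  "gen_v * gen_u = rot'" "gen_w * gen_v = rot'" "gen_u * gen_w = rot'"
  by (simp_all add: perm3_eq_iff apply_times)

lemma rot_mult:
  "rot * gen_u = gen_w" "rot * gen_v = gen_u" "rot * gen_w = gen_v"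
  "rot' * gen_u = gen_v" "rot' * gen_v = gen_w" "rot' * gen_w = gen_u"
  by (simp_all add: perm3_eq_iff apply_times)

lemma s3_neq [simp]:
  "rot \<noteq> 1" "rot' \<noteq> 1" "rot \<noteq> rot'" "rot' \<noteq> rot"
  "1 \<noteq> rot" "1 \<noteq> rot'"
  "gen_u \<noteq> gen_v" "gen_v \<noteq> gen_u" "gen_u \<noteq> gen_w" "gen_w \<noteq> gen_u" "gen_v \<noteq> gen_w" "gen_w \<noteq> gen_v"
  by (simp_all add: perm3_eq_iff)

definition cu :: cls where "cu = Abs_cls gen_u"
definition cv :: cls where "cv = Abs_cls gen_v"
definition cw :: cls where "cw = Abs_cls gen_w"

lemma elt_cls [simp]: "elt cu = gen_u" "elt cv = gen_v" "elt cw = gen_w"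
  by (simp_all add: cu_def cv_def cw_def gen_w_def Abs_cls_inverse)

lemma cls_distinct [simp]: "cu \<noteq> cv" "cv \<noteq> cu" "cu \<noteq> cw" "cw \<noteq> cu" "cv \<noteq> cw" "cw \<noteq> cv"
  using s3_neq by (auto dest!: arg_cong[of _ _ elt])

lemma UNIV_cls: "UNIV = {cu, cv, cw}"
proof -
  have "a \<in> {cu, cv, cw}" for a
    using elt_cases[of a] by (auto simp flip: elt_inject simp: gen_w_def)
  then show ?thesis by blast
qed

lemma sum_cls: "(\<Sum>a\<in>UNIV. f a) = f cu + f cv + f cw" for f :: "cls \<Rightarrow> 'a::comm_monoid_add"
  by (simp add: UNIV_cls add.assoc)

lemma all_cls: "(\<forall>a. P a) \<longleftrightarrow> P cu \<and> P cv \<and> P cw"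
  using UNIV_cls by (metis UNIV_I empty_iff insert_iff)

lemma inverse_gen_w [simp]: "inverse gen_w = gen_w"
  using inverse_elt[of cw] by simp

lemma Ad_cls [simp]:
  "Ad gen_u cu = cu" "Ad gen_v cv = cv" "Ad gen_w cw = cw"
  "Ad gen_u cv = cw" "Ad gen_v cu = cw" "Ad gen_u cw = cv"
  "Ad gen_w cu = cv" "Ad gen_v cw = cu" "Ad gen_w cv = cu"
  by (simp_all add: Ad_def gen_mult rot_mult) (simp_all add: cu_def cv_def cw_def)

lemma sum_products:
  "(\<Sum>(c, d) | elt c * elt d = x. f c d) =
    (\<Sum>c\<in>UNIV. \<Sum>d\<in>UNIV. if elt c * elt d = x then f c d else 0)"
  for f :: "cls \<Rightarrow> cls \<Rightarrow> 'a::comm_monoid_add"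
proof -
  have *: "{(c, d). elt c * elt d = x} =
      {p \<in> UNIV \<times> UNIV. case p of (c, d) \<Rightarrow> elt c * elt d = x}" by auto
  show ?thesis
    unfolding * by (subst sum.inter_filter) (auto simp: sum.cartesian_product intro!: sum.cong)
qed

section \<open>The braiding and the vanishing of two-forms\<close>

lemma \<Psi>_cls [simp]:
  "\<Psi> T cu cu = T cu cu" "\<Psi> T cv cv = T cv cv" "\<Psi> T cw cw = T cw cw"
  "\<Psi> T cw cu = T cu cv" "\<Psi> T cv cw = T cw cu" "\<Psi> T cu cv = T cv cw"
  "\<Psi> T cw cv = T cv cu" "\<Psi> T cu cw = T cw cv" "\<Psi> T cv cu = T cu cw"
  by (intro ext; simp add: \<Psi>_apply sum_cls)+

lemma abs_form2_add: "abs_form2 S + abs_form2 T = abs_form2 (S + T)"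
  and abs_form2_diff: "abs_form2 S - abs_form2 T = abs_form2 (S - T)"
  and abs_form2_lact: "f \<cdot>\<^sub>\<Omega> abs_form2 T = abs_form2 (f \<cdot>\<^sub>2 T)"
  and abs_form2_wedge: "\<omega> \<and>\<^sub>H \<eta> = abs_form2 (\<omega> \<otimes>\<^sub>H \<eta>)"
  and abs_form2_zero: "0 = abs_form2 0"
  by (simp_all add: plus_form2.abs_eq minus_form2.abs_eq lact_form2.abs_eq wedge_def zero_form2_def)

lemmas abs_form2_simps = abs_form2_add abs_form2_diff abs_form2_lact abs_form2_wedge

lemma abs_form2_eq_iff: "abs_form2 S = abs_form2 T \<longleftrightarrow> S - \<Psi> S = T - \<Psi> T"
  by (simp add: form2.abs_eq_iff form2_rel_iff)

lemma abs_form2_eq_0_iff: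
  "abs_form2 T = 0 \<longleftrightarrow>
    T cw cu = T cu cv \<and> T cv cw = T cu cv \<and> T cw cv = T cv cu \<and> T cu cw = T cv cu"
proof -
  have "abs_form2 T = 0 \<longleftrightarrow> T = \<Psi> T"
    by (simp add: abs_form2_zero abs_form2_eq_iff \<Psi>_diff[of 0 0, simplified])
  also have "\<dots> \<longleftrightarrow>
      T cw cu = T cu cv \<and> T cv cw = T cu cv \<and> T cw cv = T cv cu \<and> T cu cw = T cv cu"
    by (auto simp: fun_eq_iff[of T] fun_eq_iff[of "T _"] all_cls)
  finally show ?thesis .
qed

lemma elt_neq: "elt a \<noteq> rot" "elt a \<noteq> rot'" "elt a \<noteq> 1"
proof -
  have "elt a = gen_u \<or> elt a = gen_v \<or> elt a = gen_w"
    using elt_cases[of a] by (simp add: gen_w_def)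
  then show "elt a \<noteq> rot" "elt a \<noteq> rot'" "elt a \<noteq> 1"
    by (auto simp: perm3_eq_iff)
qed

section \<open>The connection \<open>lc\<close> and the metric\<close>

definition lc :: "cls \<Rightarrow> form1" where
  "lc = (\<lambda>a. E a - const (1/3) \<cdot>\<^sub>1 \<theta>)"

lemma lc_apply: "lc a b x = (if a = b then 2/3 else -1/3)"
proof -
  have "\<forall>a b. lc a b x = (if a = b then 2/3 else -1/3)"
    unfolding all_cls by (simp add: lc_def E_def lact1_def \<theta>_def sum_cls)
  then show ?thesis by blast
qed

lemma R_lc [simp]: "R y (lc a b) = lc a b"
  by (simp add: R_def lc_apply fun_eq_iff)

text \<open>If a = b, then ab = 1 and all three c are counted; otherwise ab is a rotation, and no
  transposition commutes with it.\<close>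

lemma killing_eq: "killing a b = (if a = b then 3 else 0)"
proof -
  have "\<forall>a b c. elt c * elt a * elt b = elt a * elt b * elt c \<longleftrightarrow> a = b"
    unfolding all_cls by (simp add: gen_mult rot_mult)
  then show ?thesis
    by (simp add: killing_def UNIV_cls)
qed

lemma tens2_eq_iff: "S = T \<longleftrightarrow> (\<forall>a b x. S a b x = T a b x)" for S T :: tens2
  by (auto simp: fun_eq_iff)

lemma metric_eq: "metric = const 3 \<cdot>\<^sub>2 (\<Sum>a\<in>UNIV. E a \<otimes>\<^sub>H E a)"
  by (simp add: tens2_eq_iff all_cls metric_def killing_eq sum_cls E_tensor_E lact2_def)

section \<open>The two lifts\<close>

lemma abs_form2_surj: "\<exists>T. \<alpha> = abs_form2 T"
  by (induct \<alpha> rule: form2.abs_induct) blast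

lemma rep_abs_form2: "rep_form2 (abs_form2 T) - \<Psi> (rep_form2 (abs_form2 T)) = T - \<Psi> T"
  using rep_abs_rsp_left[OF Quotient3_form2, of T T] by (simp add: form2_rel_iff)

text \<open>The map that id - \<Psi> induces on the quotient by its own kernel, so the choice of
  representative does not matter.\<close>

definition lift1 :: "form2 \<Rightarrow> tens2" where
  "lift1 \<alpha> = rep_form2 \<alpha> - \<Psi> (rep_form2 \<alpha>)"

lemma lift1_abs_form2: "lift1 (abs_form2 T) = T - \<Psi> T"
  by (simp add: lift1_def rep_abs_form2)

text \<open>
  On an orbit of size three this is the identity minus the orbit average, because
  \<open>T - (T + \<Psi> T + \<Psi>\<^sup>2 T) / 3 = (2 (T - \<Psi> T) + \<Psi> (T - \<Psi> T)) / 3\<close>.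
\<close>

definition lift2 :: "form2 \<Rightarrow> tens2" where
  "lift2 \<alpha> = const (2/3) \<cdot>\<^sub>2 lift1 \<alpha> + const (1/3) \<cdot>\<^sub>2 \<Psi> (lift1 \<alpha>)"

lemma bimodule_map_lift1: "bimodule_map lift1"
proof -
  have "lift1 (abs_form2 S + abs_form2 T) = lift1 (abs_form2 S) + lift1 (abs_form2 T)"
    "lift1 (f \<cdot>\<^sub>\<Omega> abs_form2 T) = f \<cdot>\<^sub>2 lift1 (abs_form2 T)"
    "lift1 (abs_form2 T \<triangleleft>\<^sub>\<Omega> f) = lift1 (abs_form2 T) \<triangleleft>\<^sub>2 f" for S T f
    by (simp_all add: abs_form2_add abs_form2_lact ract_form2.abs_eq lift1_abs_form2
        \<Psi>_add \<Psi>_lact2 \<Psi>_ract2 lact2_diff ract2_diff)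
  then show ?thesis
    unfolding bimodule_map_def by (intro conjI allI) (metis abs_form2_surj)+
qed

lemma bimodule_map_lift2: "bimodule_map lift2"
proof -
  have "lift1 (\<alpha> + \<beta>) = lift1 \<alpha> + lift1 \<beta>" "lift1 (f \<cdot>\<^sub>\<Omega> \<alpha>) = f \<cdot>\<^sub>2 lift1 \<alpha>"
    "lift1 (\<alpha> \<triangleleft>\<^sub>\<Omega> f) = lift1 \<alpha> \<triangleleft>\<^sub>2 f" for \<alpha> \<beta> f
    using bimodule_map_lift1 by (simp_all add: bimodule_map_def)
  then show ?thesis
    unfolding bimodule_map_def lift2_def
    by (simp add: \<Psi>_add \<Psi>_lact2 \<Psi>_ract2)
      (simp add: tens2_eq_iff lact2_def ract2_def algebra_simps)
qed

lemma \<Psi>_E: "\<Psi> (E a \<otimes>\<^sub>H E b) = E (Ad (elt a) b) \<otimes>\<^sub>H E a"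
proof -
  have "\<forall>a b c d x. \<Psi> (E a \<otimes>\<^sub>H E b) c d x = (E (Ad (elt a) b) \<otimes>\<^sub>H E a) c d x"
    unfolding all_cls by (simp add: E_tensor_E)
  then show ?thesis by (simp add: fun_eq_iff)
qed

lemma lift_one_lift1: "lift_one lift1"
  by (simp add: lift_one_def bimodule_map_lift1 wedge_def lift1_abs_form2 \<Psi>_E)

text \<open>For a \<noteq> b the pairs (c, d) with cd = ab form one orbit of \<Psi>, so a third of
  the sum is the orbit average.\<close>

lemma lift_two_lift2: "lift_two lift2"
proof -
  have "\<forall>a b. a \<noteq> b \<longrightarrow> lift2 (E a \<and>\<^sub>H E b) = E a \<otimes>\<^sub>H E b
        - const (1/3) \<cdot>\<^sub>2 (\<Sum>(c, d) | elt c * elt d = elt a * elt b. E c \<otimes>\<^sub>H E d)"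
    by (simp add: all_cls abs_form2_wedge lift2_def lift1_abs_form2 \<Psi>_diff \<Psi>_E sum_products sum_cls gen_mult)
      (simp add: tens2_eq_iff lact2_def algebra_simps)
  then show ?thesis
    by (simp add: lift_two_def bimodule_map_lift2)
qed

lemma form2_expand: "abs_form2 T = (\<Sum>a\<in>UNIV. \<Sum>b\<in>UNIV. T a b \<cdot>\<^sub>\<Omega> (E a \<and>\<^sub>H E b))"
proof -
  have "T = (\<Sum>a\<in>UNIV. \<Sum>b\<in>UNIV. T a b \<cdot>\<^sub>2 (E a \<otimes>\<^sub>H E b))"
    by (simp add: tens2_eq_iff all_cls sum_cls lact2_def E_tensor_E)
  then show ?thesis
    by (simp add: sum_cls abs_form2_simps)
qed

text \<open>The E_a \<and> E_b span the two-forms as a left module, and those with a = b vanish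
  because \<Psi> fixes E_a \<otimes> E_a.\<close>

lemma bimodule_map_eqI:
  assumes i: "bimodule_map i" and j: "bimodule_map j"
    and eq: "\<And>a b. a \<noteq> b \<Longrightarrow> i (E a \<and>\<^sub>H E b) = j (E a \<and>\<^sub>H E b)"
  shows "i = j"
proof
  fix \<alpha>
  have EE: "E a \<and>\<^sub>H E a = 0" for a
  proof -
    have "\<forall>a. E a \<and>\<^sub>H E a = 0"
      by (simp add: all_cls abs_form2_wedge abs_form2_eq_0_iff fun_eq_iff[where 'b=complex]
          E_tensor_E)
    then show ?thesis by blast
  qed
  have zero: "k 0 = 0" if "bimodule_map k" for k
    using that unfolding bimodule_map_def by (metis add_cancel_right_left)
  have "i (E a \<and>\<^sub>H E b) = j (E a \<and>\<^sub>H E b)" for a b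
    by (cases "a = b") (simp_all add: EE zero[OF i] zero[OF j] eq)
  moreover obtain T where "\<alpha> = abs_form2 T"
    using abs_form2_surj by blast
  ultimately show "i \<alpha> = j \<alpha>"
    using i j unfolding bimodule_map_def by (simp add: form2_expand sum_cls)
qed

lemma lift_one_iff: "lift_one i \<longleftrightarrow> i = lift1"
proof
  assume "lift_one i"
  then show "i = lift1"
    using lift_one_lift1 by (intro bimodule_map_eqI) (simp_all add: lift_one_def)
qed (simp add: lift_one_lift1)

lemma lift_two_iff: "lift_two i \<longleftrightarrow> i = lift2"
proof
  assume "lift_two i"
  then show "i = lift2"
    using lift_two_lift2 by (intro bimodule_map_eqI) (simp_all add: lift_two_def)
qed (simp add: lift_two_lift2)

section \<open>Curvature and Ricci tensor\<close>

lemma curvature_lc: "curvature lc a = dE a"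
proof -
  have d0: "d0 (lc a b) = 0" for a b
    by (simp add: d0_def lact1_def fun_eq_iff sum_cls)
  \<comment> \<open>A product of two transpositions is even, so the sum is empty.\<close>
  have "\<forall>a. (\<Sum>(c, d) | elt c * elt d = elt a. lc c \<and>\<^sub>H lc d) = 0"
    using elt_neq[symmetric]
    by (simp add: all_cls sum_products sum_cls gen_mult)
  \<comment> \<open>The \<open>lc b\<close> add up to 0, which removes the sum over b. The
    \<open>dE b\<close> add up to 2 \<theta> \<and> \<theta> = 0, so the constant multiple of
    \<theta> in \<open>lc a\<close> contributes nothing to \<open>d1 (lc a)\<close>.\<close>
  moreover have "\<forall>a. d1 (lc a) - (\<Sum>b\<in>UNIV. lc b \<and>\<^sub>H lc a + lc a \<and>\<^sub>H lc b) - dE a = 0"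
    by (simp add: all_cls d1_def d0 dE_def sum_cls abs_form2_simps abs_form2_eq_0_iff lact2_def
      tensor_def fun_eq_iff[where 'b=complex] lc_apply E_def R_def)
  ultimately show ?thesis
    by (simp add: curvature_def)
qed

lemma dE_eq: "dE a = abs_form2 (\<Sum>b\<in>UNIV. E a \<otimes>\<^sub>H E b + E b \<otimes>\<^sub>H E a)"
  by (simp add: dE_def sum_cls abs_form2_simps)

lemma lift1_dE:
  "lift1 (dE c) a b = (if a = b \<or> b = c then 0 else if a = c then 1 else - 1)"
proof -
  have "\<forall>c a b. lift1 (dE c) a b = (if a = b \<or> b = c then 0 else if a = c then 1 else - 1)"
    by (simp add: all_cls dE_eq lift1_abs_form2 sum_cls fun_eq_iff E_tensor_E)
  then show ?thesis by blast
qed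

lemma lift2_dE:
  "lift2 (dE c) a b = const (if a = b then 0 else if a = c \<or> b = c then 1/3 else - 2/3)"
proof -
  have "\<forall>c a b. lift2 (dE c) a b = const (if a = b then 0 else if a = c \<or> b = c then 1/3 else - 2/3)"
    by (simp add: all_cls dE_eq lift2_def lift1_abs_form2 sum_cls fun_eq_iff E_tensor_E lact2_def)
  then show ?thesis by blast
qed

text \<open>For a = c the second tensor factor vanishes, and for a = b or b = c the coefficient
  does. For distinct a, b, c one has cac = b, so the term is -E_b \<otimes> (E_b - E_a).\<close>

lemma ricci_lift1: "ricci lift1 lc = const 1 \<cdot>\<^sub>2 (- metric + \<theta> \<otimes>\<^sub>H \<theta>)"
  by (simp add: tens2_eq_iff all_cls ricci_def curvature_lc lift1_dE sum_cls lact2_def metric_eq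
      \<theta>_def tensor_def E_def R_def)

text \<open>Distinct a, b, c now contribute 2/3 of the terms for the first lift. The new terms with
  b = c cancel, since conjugation by c exchanges the two possible a.\<close>

lemma ricci_lift2: "ricci lift2 lc = const (2/3) \<cdot>\<^sub>2 (- metric + \<theta> \<otimes>\<^sub>H \<theta>)"
  by (simp add: tens2_eq_iff all_cls ricci_def curvature_lc lift2_dE sum_cls lact2_def metric_eq
      \<theta>_def tensor_def E_def R_def)

section \<open>Uniqueness of the Levi-Civita connection\<close>

lemma abs_form2_eq_0D:
  "abs_form2 T = 0 \<Longrightarrow>
    T cw cu x = T cu cv x \<and> T cv cw x = T cu cv x \<and>
    T cw cv x = T cv cu x \<and> T cu cw x = T cv cu x"
  by (simp add: abs_form2_eq_0_iff)

lemma torsion_zeroD: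
  assumes "\<And>a. torsion A a = 0"
  shows "A cu cv x = A cw cw x - 1" "A cv cu x = A cw cw x - 1"
    "A cu cw x = A cv cv x - 1" "A cw cu x = A cv cv x - 1"
    "A cv cw x = A cu cu x - 1" "A cw cv x = A cu cu x - 1"
    "A cu cu x + A cv cv x + A cw cw x = 2"
proof -
  note eqs = assms[of cu] assms[of cv] assms[of cw]
  note eqs = eqs[unfolded torsion_def dE_def sum_cls abs_form2_simps,
    THEN abs_form2_eq_0D, of x, unfolded tensor_def E_def R_def, simplified]
  have diag: "A cv cv x = 1 + A cw cu x" "A cv cv x = 1 + A cu cw x"
    "A cu cu x = 1 + A cw cv x" "A cu cu x = 1 + A cv cw x"
    using eqs by (blast intro: sym)+
  have "A cv cu x = - A cv cv x - A cw cv x" "A cw cw x = 1 + (- A cv cv x - A cw cv x)"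
    and sum: "A cu cv x = - A cu cu x - A cw cu x" and "A cw cw x = 1 + (- A cu cu x - A cw cu x)"
    using eqs by blast+
  then have "A cw cw x = 1 + A cv cu x" "A cw cw x = 1 + A cu cv x"
    by simp_all
  with diag show offdiag: "A cu cv x = A cw cw x - 1" "A cv cu x = A cw cw x - 1"
    "A cu cw x = A cv cv x - 1" "A cw cu x = A cv cv x - 1"
    "A cv cw x = A cu cu x - 1" "A cw cv x = A cu cu x - 1"
    by (simp_all only: add_diff_cancel_left' add_left_cancel)
  show "A cu cu x + A cv cv x + A cw cw x = 2"
    using sum unfolding offdiag by (simp add: algebra_simps)
qed

text \<open>In the cotorsion the connection is the right tensor factor, so its coefficients are
  translated: the equations at x compare values at xu, xv and xuvu.\<close>

lemma cotorsion_zeroD: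
  assumes "\<And>a. torsion A a = 0" "\<And>a. cotorsion A a = 0"
  shows "A a a (x * gen_v) = A a a (x * gen_u)" "A a a (x * gen_w) = A a a (x * gen_u)"
proof -
  note eqs = assms(2)[of cu] assms(2)[of cv] assms(2)[of cw]
  note eqs = eqs[unfolded cotorsion_def dE_def sum_cls abs_form2_simps,
    THEN abs_form2_eq_0D, of x, unfolded tensor_def E_def R_def, simplified]
  note eqs = eqs[unfolded torsion_zeroD(1-6)[OF assms(1)]]
  note sums = torsion_zeroD(7)[OF assms(1), of "x * gen_u"]
    torsion_zeroD(7)[OF assms(1), of "x * gen_v"] torsion_zeroD(7)[OF assms(1), of "x * gen_w"]
  have u: "A cu cu (x * gen_v) = A cu cu (x * gen_u)" "A cu cu (x * gen_w) = A cu cu (x * gen_u)"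
    and v: "A cv cv (x * gen_v) = A cv cv (x * gen_u)" "A cv cv (x * gen_w) = A cv cv (x * gen_u)"
    using eqs by simp_all
  \<comment> \<open>The third diagonal coefficient follows because the three always add up to
    2.\<close>
  moreover have "A cw cw (x * gen_v) = A cw cw (x * gen_u)" "A cw cw (x * gen_w) = A cw cw (x * gen_u)"
    using sums unfolding u v by (metis add_left_cancel)+
  ultimately have "\<forall>a. A a a (x * gen_v) = A a a (x * gen_u) \<and> A a a (x * gen_w) = A a a (x * gen_u)"
    unfolding all_cls by blast
  then show "A a a (x * gen_v) = A a a (x * gen_u)" "A a a (x * gen_w) = A a a (x * gen_u)"
    by blast+
qed

lemma levi_civita_unique:
  assumes "levi_civita A"
  shows "A a b x = (if a = b then 2/3 else -1/3)"
proof -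
  have tor: "\<And>a. torsion A a = 0" and cot: "\<And>a. cotorsion A a = 0" and reg: "regular A"
    using assms by (auto simp: levi_civita_def)
  \<comment> \<open>The two rotations are the only elements at which regularity is a
    condition.\<close>
  have "rot \<notin> range elt" "rot' \<notin> range elt"
    using elt_neq(1,2)[symmetric] by auto
  then have "(\<Sum>(c, d) | elt c * elt d = rot. A c \<and>\<^sub>H A d) = 0"
    "(\<Sum>(c, d) | elt c * elt d = rot'. A c \<and>\<^sub>H A d) = 0"
    using reg unfolding regular_def by simp_all
  then have eqs: "abs_form2 (A cu \<otimes>\<^sub>H A cv + A cv \<otimes>\<^sub>H A cw + A cw \<otimes>\<^sub>H A cu) = 0"
    "abs_form2 (A cu \<otimes>\<^sub>H A cw + A cv \<otimes>\<^sub>H A cu + A cw \<otimes>\<^sub>H A cv) = 0"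
    by (simp_all add: sum_products sum_cls gen_mult abs_form2_simps)
  have sub: "A cw cw y = 2 - A cu cu y - A cv cv y" for y
    using torsion_zeroD(7)[OF tor, of y] by (simp add: algebra_simps)
  have main: "A cu cu (x * gen_u) = 2/3 \<and> A cv cv (x * gen_u) = 2/3" for x
  proof -
    note eqs = eqs[THEN abs_form2_eq_0D, of x, unfolded tensor_def R_def, simplified]
    note eqs = eqs[unfolded torsion_zeroD(1-6)[OF tor] cotorsion_zeroD[OF tor cot] sub]
    have "2 + A cu cu (x * gen_u) = A cv cv x + A cv cv (x * gen_u) + 2 * A cu cu x"
      and "2 + A cv cv x = A cu cu x + A cu cu (x * gen_u) + 2 * A cv cv (x * gen_u)"
      and "2 + A cu cu x = A cv cv x + A cv cv (x * gen_u) + 2 * A cu cu (x * gen_u)"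
      and "2 + A cv cv (x * gen_u) = A cu cu x + A cu cu (x * gen_u) + 2 * A cv cv x"
      using eqs by (simp_all add: algebra_simps)
    \<comment> \<open>Here p, q are the values of \<open>A cu cu\<close>, \<open>A cv cv\<close> at
      x, and p', q' those at xu. The first and third equations give p = p', the second and fourth q
      = q'; then p + 2q = 2 = 2p + q.\<close>
    moreover have "p' = 2/3 \<and> q' = 2/3"
      if "2 + p' = q + q' + 2 * p" "2 + q = p + p' + 2 * q'"
        "2 + p = q + q' + 2 * p'" "2 + q' = p + p' + 2 * q" for p q p' q' :: complex
    proof -
      have "3 * p' = 2" "3 * q' = 2"
        using that by algebra+
      then show ?thesis by (simp add: field_simps)
    qed
    ultimately show ?thesis by blast
  qed
  \<comment> \<open>Since u squares to 1, taking xu for x in \<open>main\<close> gives the values at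
    x itself.\<close>
  have diag: "A cu cu x = 2/3" "A cv cv x = 2/3" "A cw cw x = 2/3"
    using main[of "x * gen_u"] by (simp_all add: sub mult.assoc u_square)
  have "\<forall>a b. A a b x = (if a = b then 2/3 else -1/3)"
    unfolding all_cls torsion_zeroD(1-6)[OF tor, of x] diag by simp
  then show ?thesis by blast
qed

lemma levi_civita_lc: "levi_civita lc"
proof -
  have "\<forall>a. torsion lc a = 0"
    by (simp add: all_cls torsion_def dE_def sum_cls abs_form2_simps abs_form2_eq_0_iff
        tensor_def fun_eq_iff[where 'b=complex] lc_apply E_def R_def)
  moreover have "\<forall>a. cotorsion lc a = 0"
    by (simp add: all_cls cotorsion_def dE_def sum_cls abs_form2_simps abs_form2_eq_0_iff
        tensor_def fun_eq_iff[where 'b=complex] lc_apply E_def R_def)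
  \<comment> \<open>At a rotation the sum is invariant under cyclic permutation of u, v, uvu, which
    is transitive on each orbit of size three; at any other x \<noteq> 1 it is empty.\<close>
  moreover have "(\<Sum>(c, d) | elt c * elt d = x. lc c \<and>\<^sub>H lc d) = 0" if "x \<noteq> 1" for x
    using that
    by (simp add: sum_products sum_cls gen_mult abs_form2_simps abs_form2_eq_0_iff
        tensor_def fun_eq_iff[where 'b=complex] lc_apply)
  ultimately show ?thesis
    by (auto simp: levi_civita_def regular_def)
qed

lemma levi_civita_iff: "levi_civita A \<longleftrightarrow> A = lc"
proof
  assume "levi_civita A"
  then show "A = lc"
    by (intro ext) (simp add: levi_civita_unique lc_apply)
qed (simp add: levi_civita_lc)

unbundle no permutation_syntax

theorem proposition5p9:
  shows "(\<forall>A. levi_civita A \<longleftrightarrow> A = (\<lambda>a. E a - const (1/3) \<cdot>\<^sub>1 \<theta>)) \<and>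
    metric = const 3 \<cdot>\<^sub>2 (\<Sum>a\<in>UNIV. E a \<otimes>\<^sub>H E a) \<and>
    (\<exists>!i. lift_one i) \<and> (\<exists>!i. lift_two i) \<and>
    (\<forall>A i. levi_civita A \<and> lift_one i \<longrightarrow>
       ricci i A = const 1 \<cdot>\<^sub>2 (- metric + \<theta> \<otimes>\<^sub>H \<theta>)) \<and>
    (\<forall>A i. levi_civita A \<and> lift_two i \<longrightarrow>
       ricci i A = const (2/3) \<cdot>\<^sub>2 (- metric + \<theta> \<otimes>\<^sub>H \<theta>))"
  unfolding levi_civita_iff lift_one_iff lift_two_iff lc_def [symmetric]
  using metric_eq ricci_lift1 ricci_lift2 by blast

end
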